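(* Let $0<\alpha<1$, $x>0$ and $y\in C^\infty[0,x]$. For integers $n\ge 4$ put $h=x/n$, $y_j=y(jh)$ for $0\le j\le n$, and define $$\omega_0^{(\alpha)}=1,\quad \omega_1^{(\alpha)}=\frac{1}{2^\alpha},\quad \omega_k^{(\alpha)}=\frac{1}{(k+1)^\alpha}-\frac{1}{(k-1)^\alpha}\ (2\le k\le n-2),\quad \omega_{n-1}^{(\alpha)}=-\frac{1}{(n-2)^\alpha},\quad \omega_n^{(\alpha)}=-\frac{1}{(n-1)^\alpha}.$$ Then, as $n\to\infty$ with $x$ fixed, $$\frac{1}{2\Gamma(1-\alpha)h^\alpha}\sum_{k=0}^{n}\omega_k^{(\alpha)}y_{n-k}=y^{(\alpha)}(x)+O\left(h^{1-\alpha}\right).$$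
   Context: For $0<\alpha<1$ the Caputo derivative is $y^{(\alpha)}(x)=\frac{1}{\Gamma(1-\alpha)}\int_0^x\frac{y'(t)}{(x-t)^\alpha}\,dt$. The constant implied by $O(\cdot)$ may depend on $y,\alpha,x$ but not on $n$. *)

theory Defs
  imports "HOL-Analysis.Analysis"
begin

text \<open>Derivatives are taken within the interval, hence are one-sided at its end points:
  \<open>D k\<close> is the \<open>k\<close>-th derivative of \<open>y\<close>.\<close>

definition smooth_on_interval :: "(real \<Rightarrow> real) \<Rightarrow> real \<Rightarrow> real \<Rightarrow> bool" where
  "smooth_on_interval y a b \<longleftrightarrow>
    (\<exists>D :: nat \<Rightarrow> real \<Rightarrow> real.
      (\<forall>t\<in>{a..b}. D 0 t = y t) \<and>
      (\<forall>k. \<forall>t\<in>{a..b}. (D k has_real_derivative D (Suc k) t) (at t within {a..b})))"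

text \<open>The derivative is taken within \<open>{0..x}\<close>, so only the values of \<open>y\<close> on \<open>{0..x}\<close> matter.
  At the singularity \<open>t = x\<close> the totalised integrand is 0, which does not affect the integral.\<close>

definition caputo_derivative :: "real \<Rightarrow> (real \<Rightarrow> real) \<Rightarrow> real \<Rightarrow> real" where
  "caputo_derivative \<alpha> y x =
    1 / Gamma (1 - \<alpha>) *
    integral {0..x} (\<lambda>t. vector_derivative y (at t within {0..x}) / (x - t) powr \<alpha>)"

text \<open>The cases are mutually exclusive for \<open>n \<ge> 4\<close>, the only range for which the weights are
  meant; the values for smaller \<open>n\<close> are junk.\<close>

definition caputo_weight :: "real \<Rightarrow> nat \<Rightarrow> nat \<Rightarrow> real" where
  "caputo_weight \<alpha> n k =
    (if k = 0 then 1
     else if k = 1 then 1 / 2 powr \<alpha>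
     else if k + 2 \<le> n then 1 / (real k + 1) powr \<alpha> - 1 / (real k - 1) powr \<alpha>
     else if k + 1 = n then - (1 / (real n - 2) powr \<alpha>)
     else if k = n then - (1 / (real n - 1) powr \<alpha>)
     else 0)"

definition caputo_approx :: "real \<Rightarrow> (real \<Rightarrow> real) \<Rightarrow> real \<Rightarrow> nat \<Rightarrow> real" where
  "caputo_approx \<alpha> y x n =
    (let h = x / real n in
      1 / (2 * Gamma (1 - \<alpha>) * h powr \<alpha>) *
      (\<Sum>k=0..n. caputo_weight \<alpha> n k * y (real (n - k) * h)))"

end

theory Submission
  imports Defs
begin

text \<open>
  Write \<open>c k = k powr -\<alpha>\<close> for \<open>0 < k < n\<close> and \<open>c k = 0\<close> for \<open>k = 0\<close> and for \<open>k \<ge> n\<close>.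
  The weights are the central differences \<open>c (k + 1) - c (k - 1)\<close>, so summation by parts turns
  the weighted sum of the values of \<open>y\<close> into
  \<open>\<Sum>k<n. (c k + c (k + 1)) * (y (x - k h) - y (x - (k + 1) h))\<close>.
  Each increment of \<open>y\<close> is the integral of \<open>y'\<close> over a cell \<open>{x - (k + 1) h..x - k h}\<close>.
  Up to the factor \<open>1 / Gamma (1 - \<alpha>)\<close>, the approximation is therefore the Caputo integral with
  the kernel \<open>(x - t) powr -\<alpha>\<close> replaced, on the \<open>k\<close>-th cell, by the constant
  \<open>(c k + c (k + 1)) / 2\<close> times \<open>h powr -\<alpha>\<close>.

  For \<open>k \<ge> 1\<close> both the kernel and this constant lie between \<open>c (k + 1) * h powr -\<alpha>\<close> and
  \<open>c k * h powr -\<alpha>\<close>. With \<open>\<bar>y'\<bar> \<le> M\<close> the cell contributes an error of at most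
  \<open>M * h * h powr -\<alpha> * (c k - c (k + 1))\<close>, and these bounds telescope to
  \<open>M * h powr (1 - \<alpha>)\<close>; the truncation of \<open>c\<close> at \<open>n\<close> makes the cell farthest from
  the singularity part of the same telescope. On the cell \<open>k = 0\<close>, which contains the singularity,
  the kernel and the constant are integrated separately, and each integral is of order
  \<open>h powr (1 - \<alpha>)\<close> (lemma \<open>has_integral_reflected_power\<close>).
\<close>

section \<open>The weights as central differences\<close>

definition truncated_power :: "real \<Rightarrow> nat \<Rightarrow> nat \<Rightarrow> real" where
  "truncated_power \<alpha> n k = (if k < n then real k powr - \<alpha> else 0)"

text \<open>The four special cases in the definition of the weights come from the two ends of the support
  of the truncated sequence: \<open>0 powr -\<alpha> = 0\<close> at the lower end, the truncation at the upper end. At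
  \<open>k = 0\<close> the truncated subtraction \<open>k - 1 = 0\<close> selects the vanishing term.\<close>

lemma caputo_weight_eq_central_difference:
  assumes "4 \<le> n" and "k \<le> n"
  shows "caputo_weight \<alpha> n k = truncated_power \<alpha> n (Suc k) - truncated_power \<alpha> n (k - 1)"
proof -
  consider "k = 0" | "k = 1" | "2 \<le> k" "k + 2 \<le> n" | "k + 1 = n" | "k = n"
    using assms by linarith
  then show ?thesis
  proof cases
    case 3
    then show ?thesis
      by (simp add: caputo_weight_def truncated_power_def powr_minus_divide of_nat_diff add.commute)
  next
    case 4
    then have "n = Suc k" "2 \<le> k"
      using assms by auto
    then show ?thesis
      by (simp add: caputo_weight_def truncated_power_def powr_minus_divide of_nat_diff)
  next
    case 5
    then show ?thesis using assms
      by (simp add: caputo_weight_def truncated_power_def powr_minus_divide of_nat_diff)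
  qed (use assms in \<open>simp_all add: caputo_weight_def truncated_power_def powr_minus_divide\<close>)
qed

lemma sum_central_difference_by_parts:
  fixes c Y :: "nat \<Rightarrow> 'a::comm_ring"
  assumes "c 0 = 0"
  shows "(\<Sum>k\<le>n. (c (Suc k) - c (k - 1)) * Y k) =
    (\<Sum>k<n. (c k + c (Suc k)) * (Y k - Y (Suc k))) + (c n + c (Suc n)) * Y n"
  by (induction n) (simp_all add: assms algebra_simps)

section \<open>Integrals against the singular kernel\<close>

lemma has_integral_reflected_power:
  fixes \<alpha> x a :: real
  assumes "\<alpha> < 1" and "a \<le> x"
  shows "((\<lambda>t. (x - t) powr - \<alpha>) has_integral (x - a) powr (1 - \<alpha>) / (1 - \<alpha>)) {a..x}"
proof -
  let ?F = "\<lambda>t. - ((x - t) powr (1 - \<alpha>) / (1 - \<alpha>))"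
  have "((\<lambda>t. (x - t) powr - \<alpha>) has_integral (?F x - ?F a)) {a..x}"
  proof (rule fundamental_theorem_of_calculus_interior)
    show "continuous_on {a..x} ?F"
      using assms by (intro continuous_intros continuous_on_powr') auto
    fix t assume "t \<in> {a<..<x}"
    then have "((\<lambda>t. (x - t) powr (1 - \<alpha>)) has_real_derivative
        - ((1 - \<alpha>) * (x - t) powr - \<alpha>)) (at t)"
      by (auto intro!: derivative_eq_intros)
    from DERIV_minus[OF DERIV_cdivide[OF this, of "1 - \<alpha>"]]
    have "(?F has_real_derivative (x - t) powr - \<alpha>) (at t)"
      using assms(1) by simp
    then show "(?F has_vector_derivative (x - t) powr - \<alpha>) (at t)"
      by (simp add: has_real_derivative_iff_has_vector_derivative)
  qed (use assms in simp)
  then show ?thesis by simp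
qed

lemma continuous_times_reflected_power_integrable:
  fixes d :: "real \<Rightarrow> real"
  assumes "\<alpha> < 1" and "a \<le> x" and "continuous_on {a..x} d"
  shows "(\<lambda>t. d t * (x - t) powr - \<alpha>) integrable_on {a..x}"
proof -
  have "(\<lambda>t. (x - t) powr - \<alpha>) absolutely_integrable_on {a..x}"
    using has_integral_reflected_power[OF assms(1,2)]
    by (intro nonnegative_absolutely_integrable_1) auto
  moreover have "bounded (d ` {a..x})"
    using assms(3) by (intro compact_imp_bounded compact_continuous_image) auto
  ultimately have "(\<lambda>t. d t * (x - t) powr - \<alpha>) absolutely_integrable_on {a..x}"
    using assms(3)
    by (intro absolutely_integrable_bounded_measurable_product_real
        continuous_imp_measurable_on_sets_lebesgue) auto
  then show ?thesis
    by (rule set_lebesgue_integral_eq_integral(1))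
qed

text \<open>With \<open>d = y'\<close> the number \<open>I\<close> is an increment of \<open>y\<close>, and \<open>w * I\<close> is the integral of \<open>d\<close> against
  the constant \<open>w\<close> in place of \<open>K\<close>. The majorant \<open>B\<close> is a function rather than a number so that the
  singular cell is covered as well.\<close>

lemma constant_kernel_error:
  fixes d K B :: "real \<Rightarrow> real"
  assumes d: "(d has_integral I) S" and dK: "(\<lambda>t. d t * K t) integrable_on S"
    and B: "(B has_integral J) S"
    and M: "\<And>t. t \<in> S \<Longrightarrow> \<bar>d t\<bar> \<le> M" and w: "\<And>t. t \<in> S \<Longrightarrow> \<bar>w - K t\<bar> \<le> B t"
  shows "\<bar>w * I - integral S (\<lambda>t. d t * K t)\<bar> \<le> M * J"
proof -
  have e: "((\<lambda>t. w * d t - d t * K t) has_integral (w * I - integral S (\<lambda>t. d t * K t))) S"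
    by (intro has_integral_diff has_integral_mult_right d integrable_integral dK)
  have b: "((\<lambda>t. M * B t) has_integral M * J) S"
    by (intro has_integral_mult_right B)
  have "norm (w * d t - d t * K t) \<le> M * B t" if "t \<in> S" for t
  proof -
    have "norm (w * d t - d t * K t) = \<bar>d t\<bar> * \<bar>w - K t\<bar>"
      by (simp add: abs_mult[symmetric] algebra_simps)
    also have "\<dots> \<le> M * B t"
      using M[OF that] w[OF that] by (intro mult_mono) auto
    finally show ?thesis .
  qed
  then have "norm (integral S (\<lambda>t. w * d t - d t * K t)) \<le> integral S (\<lambda>t. M * B t)"
    using e b by (intro integral_norm_bound_integral) auto
  then show ?thesis
    unfolding integral_unique[OF e] integral_unique[OF b] by simp
qed

lemma sum_integral_backward_cells:
  fixes f :: "real \<Rightarrow> real"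
  assumes "0 \<le> h" and "f integrable_on {x - real n * h..x}"
  shows "(\<Sum>k<n. integral {x - real (Suc k) * h..x - real k * h} f) =
    integral {x - real n * h..x} f"
  using assms(2)
proof (induction n)
  case (Suc n)
  have le: "x - real (Suc n) * h \<le> x - real n * h" "x - real n * h \<le> x"
    using assms(1) by (auto simp: algebra_simps)
  have "f integrable_on {x - real n * h..x}"
    using Suc.prems by (rule integrable_on_subinterval) (use le in auto)
  with Suc.IH Henstock_Kurzweil_Integration.integral_combine[OF le Suc.prems] show ?case
    by simp
qed simp

section \<open>The error on a single cell\<close>

text \<open>The kernel decreases in \<open>x - t\<close>, so on the cell it stays between its end point values, and the
  constant is their mean; the difference of these values bounds the deviation. On the cell
  \<open>k = n - 1\<close> the lower value is replaced by 0, which still is a lower bound. Stating the bound with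
  the truncated sequence makes it telescope over all \<open>k \<ge> 1\<close>.\<close>

lemma regular_cell_error:
  fixes d :: "real \<Rightarrow> real"
  assumes "0 < \<alpha>" and "0 < h" and "1 \<le> k" and "k < n"
    and d: "(d has_integral I) {x - real (Suc k) * h..x - real k * h}"
    and dK: "(\<lambda>t. d t * (x - t) powr - \<alpha>) integrable_on {x - real (Suc k) * h..x - real k * h}"
    and M: "\<And>t. t \<in> {x - real (Suc k) * h..x - real k * h} \<Longrightarrow> \<bar>d t\<bar> \<le> M"
  shows "\<bar>h powr - \<alpha> * (truncated_power \<alpha> n k + truncated_power \<alpha> n (Suc k)) / 2 * I
      - integral {x - real (Suc k) * h..x - real k * h} (\<lambda>t. d t * (x - t) powr - \<alpha>)\<bar>
    \<le> M * (h powr (1 - \<alpha>) * (truncated_power \<alpha> n k - truncated_power \<alpha> n (Suc k)))"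
proof -
  let ?a = "h powr - \<alpha> * truncated_power \<alpha> n k"
  let ?b = "h powr - \<alpha> * truncated_power \<alpha> n (Suc k)"
  let ?S = "{x - real (Suc k) * h..x - real k * h}"
  have hh: "h * h powr - \<alpha> = h powr (1 - \<alpha>)"
    using assms(2) by (simp add: powr_mult_base)
  have "((\<lambda>t. ?a - ?b) has_integral (x - real k * h - (x - real (Suc k) * h)) *\<^sub>R (?a - ?b)) ?S"
    using has_integral_const_real[of "?a - ?b" "x - real (Suc k) * h" "x - real k * h"] assms(2)
    by (simp add: algebra_simps)
  also have "(x - real k * h - (x - real (Suc k) * h)) *\<^sub>R (?a - ?b) =
      h * h powr - \<alpha> * (truncated_power \<alpha> n k - truncated_power \<alpha> n (Suc k))"
    by (simp add: algebra_simps)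
  finally have B: "((\<lambda>t. ?a - ?b) has_integral
      h powr (1 - \<alpha>) * (truncated_power \<alpha> n k - truncated_power \<alpha> n (Suc k))) ?S"
    unfolding hh .
  have w: "\<bar>(?a + ?b) / 2 - (x - t) powr - \<alpha>\<bar> \<le> ?a - ?b" if "t \<in> ?S" for t
  proof -
    have t: "real k * h \<le> x - t" "x - t \<le> real (Suc k) * h" and kh: "0 < real k * h"
      using that assms by auto
    have "(x - t) powr - \<alpha> \<le> (real k * h) powr - \<alpha>"
      using t kh assms(1) by (intro powr_mono2') auto
    also have "\<dots> = ?a"
      using assms by (simp add: truncated_power_def powr_mult mult.commute)
    finally have upper: "(x - t) powr - \<alpha> \<le> ?a" .
    have "?b \<le> (real (Suc k) * h) powr - \<alpha>"
      using assms by (simp add: truncated_power_def powr_mult mult.commute)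
    also have "\<dots> \<le> (x - t) powr - \<alpha>"
      using t kh assms(1) by (intro powr_mono2') auto
    finally have "?b \<le> (x - t) powr - \<alpha>" .
    moreover have "\<bar>(p + q) / 2 - r\<bar> \<le> p - q" if "q \<le> r" "r \<le> p" for p q r :: real
      using that by (simp add: abs_le_iff field_simps)
    ultimately show ?thesis using upper by blast
  qed
  have "\<bar>(?a + ?b) / 2 * I - integral ?S (\<lambda>t. d t * (x - t) powr - \<alpha>)\<bar>
      \<le> M * (h powr (1 - \<alpha>) * (truncated_power \<alpha> n k - truncated_power \<alpha> n (Suc k)))"
    by (rule constant_kernel_error[OF d dK B M w])
  then show ?thesis by (simp add: algebra_simps)
qed

text \<open>The kernel is unbounded here, so it is not compared with the constant pointwise: the deviation is
  bounded by the sum of the two, whose integral has the same order as the telescoped sum. The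
  constant is \<open>h powr -\<alpha> * (c 0 + c 1) / 2\<close> with \<open>c 0 = 0\<close> and \<open>c 1 = 1\<close>.\<close>

lemma singular_cell_error:
  fixes d :: "real \<Rightarrow> real"
  assumes "\<alpha> < 1" and "0 < h"
    and d: "(d has_integral I) {x - h..x}"
    and dK: "(\<lambda>t. d t * (x - t) powr - \<alpha>) integrable_on {x - h..x}"
    and M: "\<And>t. t \<in> {x - h..x} \<Longrightarrow> \<bar>d t\<bar> \<le> M"
  shows "\<bar>h powr - \<alpha> / 2 * I - integral {x - h..x} (\<lambda>t. d t * (x - t) powr - \<alpha>)\<bar>
    \<le> M * (h powr (1 - \<alpha>) * (1 / 2 + 1 / (1 - \<alpha>)))"
proof -
  have hh: "h * h powr - \<alpha> = h powr (1 - \<alpha>)"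
    using assms(2) by (simp add: powr_mult_base)
  have "((\<lambda>t. h powr - \<alpha> / 2) has_integral (h powr (1 - \<alpha>) / 2)) {x - h..x}"
    using has_integral_const_real[of "h powr - \<alpha> / 2" "x - h" x] assms(2) hh by simp
  moreover have "((\<lambda>t. (x - t) powr - \<alpha>) has_integral h powr (1 - \<alpha>) / (1 - \<alpha>)) {x - h..x}"
    using has_integral_reflected_power[of \<alpha> "x - h" x] assms by simp
  ultimately have B: "((\<lambda>t. h powr - \<alpha> / 2 + (x - t) powr - \<alpha>) has_integral
      (h powr (1 - \<alpha>) / 2 + h powr (1 - \<alpha>) / (1 - \<alpha>))) {x - h..x}"
    by (rule has_integral_add)
  have "\<bar>h powr - \<alpha> / 2 - (x - t) powr - \<alpha>\<bar> \<le> h powr - \<alpha> / 2 + (x - t) powr - \<alpha>" for t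
    using powr_ge_zero[of h "- \<alpha>"] powr_ge_zero[of "x - t" "- \<alpha>"] by linarith
  from constant_kernel_error[OF d dK B M this] show ?thesis
    by (simp add: algebra_simps)
qed

section \<open>The order of the approximation\<close>

text \<open>A central difference \<open>y (x - (k - 1) h) - y (x - (k + 1) h)\<close> spans two cells. Collecting its
  increments by cells leaves, on each cell, the mean of the two values of the truncated kernel at the
  end points; the boundary term of the summation by parts vanishes because of the truncation.\<close>

lemma caputo_approx_eq_cell_sum:
  fixes x :: real
  assumes "4 \<le> n"
  defines "h \<equiv> x / real n"
  shows "caputo_approx \<alpha> y x n = 1 / Gamma (1 - \<alpha>) *
    (\<Sum>k<n. h powr - \<alpha> * (truncated_power \<alpha> n k + truncated_power \<alpha> n (Suc k)) / 2 *
      (y (x - real k * h) - y (x - real (Suc k) * h)))"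
proof -
  let ?c = "truncated_power \<alpha> n"
  let ?Y = "\<lambda>k. y (x - real k * h)"
  have nh: "real n * h = x"
    using assms(1) by (simp add: h_def)
  have node: "y (real (n - k) * h) = ?Y k" if "k \<le> n" for k
    using that nh by (simp add: of_nat_diff left_diff_distrib)
  have "(\<Sum>k=0..n. caputo_weight \<alpha> n k * y (real (n - k) * h)) =
      (\<Sum>k\<le>n. (?c (Suc k) - ?c (k - 1)) * ?Y k)"
    unfolding atMost_atLeast0
    by (intro sum.cong refl) (simp only: atLeastAtMost_iff node
        caputo_weight_eq_central_difference[OF assms(1)])
  also have "\<dots> = (\<Sum>k<n. (?c k + ?c (Suc k)) * (?Y k - ?Y (Suc k))) + (?c n + ?c (Suc n)) * ?Y n"
    by (rule sum_central_difference_by_parts) (simp add: truncated_power_def)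
  also have "(?c n + ?c (Suc n)) * ?Y n = 0"
    by (simp add: truncated_power_def)
  finally show ?thesis
    unfolding caputo_approx_def Let_def h_def[symmetric]
    by (simp add: sum_distrib_left powr_minus_divide field_simps)
qed

theorem mainTheorem8:
  fixes \<alpha> x :: real and y :: "real \<Rightarrow> real"
  assumes "0 < \<alpha>" and "\<alpha> < 1" and "0 < x"
    and "smooth_on_interval y 0 x"
  shows "\<exists>C::real. \<forall>n::nat. n \<ge> 4 \<longrightarrow>
    \<bar>caputo_approx \<alpha> y x n - caputo_derivative \<alpha> y x\<bar> \<le> C * (x / real n) powr (1 - \<alpha>)"
proof -
  obtain D where D0: "\<And>t. t \<in> {0..x} \<Longrightarrow> D 0 t = y t"
    and D: "\<And>k t. t \<in> {0..x} \<Longrightarrow> (D k has_real_derivative D (Suc k) t) (at t within {0..x})"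
    using assms(4) unfolding smooth_on_interval_def by metis
  define d where "d = D 1"
  have y': "(y has_real_derivative d t) (at t within {0..x})" if "t \<in> {0..x}" for t
    using has_field_derivative_transform_within[OF D[OF that, of 0] zero_less_one that] D0
    by (simp add: d_def)
  have cont: "continuous_on {0..x} d"
    unfolding d_def using D by (intro DERIV_continuous_on) auto
  then have "bounded (d ` {0..x})"
    by (intro compact_imp_bounded compact_continuous_image) auto
  then obtain M where M: "\<And>t. t \<in> {0..x} \<Longrightarrow> \<bar>d t\<bar> \<le> M"
    unfolding bounded_iff real_norm_def by blast
  let ?f = "\<lambda>t. d t * (x - t) powr - \<alpha>"
  have f: "?f integrable_on {0..x}"
    using assms cont by (intro continuous_times_reflected_power_integrable) auto
  have "vector_derivative y (at t within {0..x}) / (x - t) powr \<alpha> = ?f t" if "t \<in> {0..x}" for t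
  proof -
    have "vector_derivative y (at t within {0..x}) = d t"
      using y'[OF that] that assms(3)
      by (intro vector_derivative_within_closed_interval)
        (auto simp: has_real_derivative_iff_has_vector_derivative)
    then show ?thesis by (simp add: powr_minus_divide)
  qed
  then have caputo: "caputo_derivative \<alpha> y x = 1 / Gamma (1 - \<alpha>) * integral {0..x} ?f"
    unfolding caputo_derivative_def by (metis (no_types, lifting) integral_cong)
  have G: "0 < Gamma (1 - \<alpha>)" using assms by (intro Gamma_real_pos) auto
  define C where "C = 1 / Gamma (1 - \<alpha>) * (M * (3 / 2 + 1 / (1 - \<alpha>)))"
  have "\<bar>caputo_approx \<alpha> y x n - caputo_derivative \<alpha> y x\<bar> \<le> C * (x / real n) powr (1 - \<alpha>)"
    if n: "4 \<le> n" for n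
  proof -
    define h where "h = x / real n"
    have h: "0 < h" and nh: "real n * h = x" using assms n by (auto simp: h_def)
    let ?c = "truncated_power \<alpha> n"
    let ?S = "\<lambda>k. {x - real (Suc k) * h..x - real k * h}"
    let ?I = "\<lambda>k. y (x - real k * h) - y (x - real (Suc k) * h)"
    let ?E = "\<lambda>k. h powr - \<alpha> * (?c k + ?c (Suc k)) / 2 * ?I k - integral (?S k) ?f"
    have S: "?S k \<subseteq> {0..x}" if "k < n" for k
    proof -
      have "real (Suc k) * h \<le> real n * h"
        using that h by (intro mult_right_mono) auto
      moreover have "0 \<le> real k * h"
        using h by simp
      ultimately show ?thesis
        using nh by auto
    qed
    have I: "(d has_integral ?I k) (?S k)" if "k < n" for k
    proof (rule fundamental_theorem_of_calculus)
      show "x - real (Suc k) * h \<le> x - real k * h" using h by (simp add: algebra_simps)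
      fix t assume "t \<in> ?S k"
      then show "(y has_vector_derivative d t) (at t within ?S k)"
        using has_field_derivative_subset[OF y' S[OF that]] S[OF that]
        by (auto simp: has_real_derivative_iff_has_vector_derivative[symmetric])
    qed
    have fS: "?f integrable_on ?S k" if "k < n" for k
      using f S[OF that] by (rule integrable_on_subinterval)
    have MS: "\<bar>d t\<bar> \<le> M" if "k < n" "t \<in> ?S k" for k t
      using M S[OF that(1)] that(2) by blast
    have c01: "?c 0 = 0" "?c (Suc 0) = 1" "?c n = 0"
      using n by (auto simp: truncated_power_def)
    have n0: "0 < n" using n by simp
    have E0: "\<bar>?E 0\<bar> \<le> M * (h powr (1 - \<alpha>) * (1 / 2 + 1 / (1 - \<alpha>)))"
      using singular_cell_error[of \<alpha> h d "?I 0" x M] I[OF n0] fS[OF n0] MS[OF n0] assms h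
      by (simp add: c01)
    have E: "\<bar>?E k\<bar> \<le> M * (h powr (1 - \<alpha>) * (?c k - ?c (Suc k)))" if "k \<in> {1..<n}" for k
      using that assms(1) h by (intro regular_cell_error I fS MS) auto
    have split: "{..<n} = insert 0 {1..<n}" using n by auto
    have "(\<Sum>k<n. integral (?S k) ?f) = integral {0..x} ?f"
      using sum_integral_backward_cells[of h ?f x n] h f nh by simp
    then have "\<bar>(\<Sum>k<n. h powr - \<alpha> * (?c k + ?c (Suc k)) / 2 * ?I k) - integral {0..x} ?f\<bar> =
        \<bar>\<Sum>k<n. ?E k\<bar>"
      unfolding sum_subtractf by simp
    also have "\<dots> \<le> (\<Sum>k<n. \<bar>?E k\<bar>)" by (rule sum_abs)
    also have "\<dots> = \<bar>?E 0\<bar> + (\<Sum>k\<in>{1..<n}. \<bar>?E k\<bar>)"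
      unfolding split by (subst sum.insert) auto
    also have "\<dots> \<le> M * (h powr (1 - \<alpha>) * (1 / 2 + 1 / (1 - \<alpha>))) +
        (\<Sum>k\<in>{1..<n}. M * (h powr (1 - \<alpha>) * (?c k - ?c (Suc k))))"
      by (intro add_mono sum_mono E0 E)
    also have "(\<Sum>k\<in>{1..<n}. M * (h powr (1 - \<alpha>) * (?c k - ?c (Suc k)))) =
        M * (h powr (1 - \<alpha>) * (\<Sum>k\<in>{1..<n}. ?c k - ?c (Suc k)))"
      by (simp only: sum_distrib_left)
    also have "(\<Sum>k\<in>{1..<n}. ?c k - ?c (Suc k)) = 1"
      using sum_Suc_diff'[of 1 n "\<lambda>k. - ?c k"] n c01 by simp
    also have "M * (h powr (1 - \<alpha>) * (1 / 2 + 1 / (1 - \<alpha>))) + M * (h powr (1 - \<alpha>) * 1) =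
        M * (3 / 2 + 1 / (1 - \<alpha>)) * h powr (1 - \<alpha>)"
      by (simp add: algebra_simps)
    finally have "\<bar>(\<Sum>k<n. h powr - \<alpha> * (?c k + ?c (Suc k)) / 2 * ?I k) - integral {0..x} ?f\<bar>
      \<le> M * (3 / 2 + 1 / (1 - \<alpha>)) * h powr (1 - \<alpha>)" .
    from mult_left_mono[OF this, of "1 / Gamma (1 - \<alpha>)"] G show ?thesis
      unfolding caputo caputo_approx_eq_cell_sum[OF n] h_def[symmetric] C_def
        right_diff_distrib[symmetric] abs_mult
      by (simp add: mult.assoc)
  qed
  then show ?thesis by blast
qed

end
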